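(* For all $\ell>0$, the functions $v_\ell$ and $V_\ell$ are continuous on $\mathrm{int}(\Omega)$.
   Context: $C\subset\mathbb{R}^m$ is a closed, convex, pointed cone with nonempty interior. $C^*=\{c^*\in\mathbb{R}^m:\langle c^*,c\rangle\ge 0\ \forall c\in C\}$ and $G=\mathrm{conv}(\{c^*\in C^*:\|c^*\|=1\})$. $\Omega\subset\mathbb{R}^n$ is closed and convex with nonempty interior, and $F:\mathbb{R}^n\to\mathbb{R}^m$ is a function each of whose components $F_i$ is differentiable, with Jacobian $JF(x)\in\mathbb{R}^{m\times n}$. Legendre function: a proper closed convex function $\omega:X\to(-\infty,+\infty]$, $X\subset\mathbb{R}^n$, that is essentially smooth (differentiable on $\mathrm{int}(\mathrm{dom}\,\omega)$, with $\|\nabla\omega(x^k)\|\to\infty$ for every sequence $\{x^k\}\subset\mathrm{int}(\mathrm{dom}\,\omega)$ converging to a boundary point of $\mathrm{dom}\,\omega$) and strictly convex on $\mathrm{int}(\mathrm{dom}\,\omega)$. Here $\omega$ is a Legendre function with $\mathrm{cl}(\mathrm{dom}\,\omega)=\Omega$ (so $\mathrm{int}(\mathrm{dom}\,\omega)=\mathrm{int}(\Omega)$). Bregman distance: $D_\omega(x,y)=\omega(x)-\omega(y)-\langle\nabla\omega(y),x-y\rangle$ for $x\in\mathrm{dom}\,\omega$, $y\in\mathrm{int}(\mathrm{dom}\,\omega)$ (read as $+\infty$ when $\omega(x)=+\infty$). For $\ell>0$: $v_\ell(x)=\sup_{y\in\Omega}\min_{c^*\in G}\{\langle c^*,JF(x)(x-y)\rangle-\ell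 D_\omega(y,x)\}$, and $V_\ell(x)$ is the maximizer $y$ in this supremum. Standing assumption: $V_\ell$ is a well-defined single-valued mapping from $\mathrm{int}(\Omega)$ to $\mathrm{int}(\Omega)$, i.e. for each $x\in\mathrm{int}(\Omega)$ the maximizer exists, is unique, and lies in $\mathrm{int}(\Omega)$.
   Formalization: The Jacobian JF is additionally assumed continuous on int(Ω); with F merely differentiable the claim fails, e.g. F(x)=x² sin(1/x), F(0)=0, C=[0,∞), Ω=ℝ, ω(x)=x²/2, where v_ℓ and V_ℓ are discontinuous at 0. *)

theory Defs
  imports "HOL-Analysis.Analysis"
begin

definition pointed :: "'a::real_vector set \<Rightarrow> bool" where
  "pointed C \<longleftrightarrow> C \<inter> uminus ` C = {0}"

definition dual_cone :: "'a::real_inner set \<Rightarrow> 'a set" where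
  "dual_cone C = {c'. \<forall>c\<in>C. 0 \<le> c' \<bullet> c}"

definition dual_generator :: "'a::real_inner set \<Rightarrow> 'a set" where
  "dual_generator C = convex hull {c' \<in> dual_cone C. norm c' = 1}"

text \<open>
  An extended-real-valued function on a subset \<open>X\<close> is a total function to \<^typ>\<open>ereal\<close> together
  with the set \<open>X\<close>; its values outside \<open>X\<close> play no role.
\<close>

definition edom :: "'a set \<Rightarrow> ('a \<Rightarrow> ereal) \<Rightarrow> 'a set" where
  "edom X w = {x \<in> X. w x < \<infinity>}"

definition eepigraph :: "'a set \<Rightarrow> ('a \<Rightarrow> ereal) \<Rightarrow> ('a \<times> real) set" where
  "eepigraph X w = {(x, t). x \<in> X \<and> w x \<le> ereal t}"

definition proper_fun :: "'a set \<Rightarrow> ('a \<Rightarrow> ereal) \<Rightarrow> bool" where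
  "proper_fun X w \<longleftrightarrow> (\<forall>x\<in>X. w x \<noteq> -\<infinity>) \<and> edom X w \<noteq> {}"

text \<open>
  The passage through \<^const>\<open>real_of_ereal\<close> is harmless on the interior of the domain, where a
  proper function is finite in a whole neighbourhood.
\<close>

definition egrad :: "('a::euclidean_space \<Rightarrow> ereal) \<Rightarrow> 'a \<Rightarrow> 'a" where
  "egrad w x = (THE g. GDERIV (\<lambda>z. real_of_ereal (w z)) x :> g)"

definition essentially_smooth :: "'a::euclidean_space set \<Rightarrow> ('a \<Rightarrow> ereal) \<Rightarrow> bool" where
  "essentially_smooth X w \<longleftrightarrow>
     (\<forall>x \<in> interior (edom X w). (\<lambda>z. real_of_ereal (w z)) differentiable (at x)) \<and>
     (\<forall>xs x. (\<forall>k::nat. xs k \<in> interior (edom X w)) \<and> xs \<longlonglongrightarrow> x \<and> x \<in> frontier (edom X w)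
        \<longrightarrow> filterlim (\<lambda>k. norm (egrad w (xs k))) at_top sequentially)"

definition strictly_convex_on :: "'a::real_vector set \<Rightarrow> ('a \<Rightarrow> ereal) \<Rightarrow> bool" where
  "strictly_convex_on S w \<longleftrightarrow>
     convex S \<and>
     (\<forall>x\<in>S. \<forall>y\<in>S. \<forall>t. x \<noteq> y \<and> 0 < t \<and> t < 1
        \<longrightarrow> w ((1 - t) *\<^sub>R x + t *\<^sub>R y) < ereal (1 - t) * w x + ereal t * w y)"

definition legendre :: "'a::euclidean_space set \<Rightarrow> ('a \<Rightarrow> ereal) \<Rightarrow> bool" where
  "legendre X w \<longleftrightarrow>
     proper_fun X w \<and> closed (eepigraph X w) \<and> convex (eepigraph X w) \<and>
     essentially_smooth X w \<and> strictly_convex_on (interior (edom X w)) w"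

definition bregman :: "'a::euclidean_space set \<Rightarrow> ('a \<Rightarrow> ereal) \<Rightarrow> 'a \<Rightarrow> 'a \<Rightarrow> ereal" where
  "bregman X w x y =
     (if x \<in> edom X w then w x - w y - ereal (egrad w y \<bullet> (x - y)) else \<infinity>)"

text \<open>
  \<open>merit_obj\<close> is the function of \<open>y\<close> that is maximised. The infimum in it is a minimum whenever
  \<open>dual_generator C\<close> is nonempty, since the latter is compact. It equals \<open>-\<infinity>\<close> for \<open>y\<close> outside the
  domain of \<open>w\<close>, and \<open>0\<close> for \<open>y = x\<close> in the interior of that domain.
\<close>

definition merit_obj ::
  "(real^'m) set \<Rightarrow> (real^'n \<Rightarrow> real^'m) \<Rightarrow> (real^'n) set \<Rightarrow> (real^'n \<Rightarrow> ereal) \<Rightarrow>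
    real \<Rightarrow> real^'n \<Rightarrow> real^'n \<Rightarrow> ereal" where
  "merit_obj C F X w l x y =
     (INF c \<in> dual_generator C.
        ereal (c \<bullet> (jacobian F (at x) *v (x - y))) - ereal l * bregman X w y x)"

definition merit ::
  "(real^'m) set \<Rightarrow> (real^'n \<Rightarrow> real^'m) \<Rightarrow> (real^'n) set \<Rightarrow> (real^'n) set \<Rightarrow>
    (real^'n \<Rightarrow> ereal) \<Rightarrow> real \<Rightarrow> real^'n \<Rightarrow> ereal" where
  "merit C F \<Omega> X w l x = (SUP y \<in> \<Omega>. merit_obj C F X w l x y)"

definition merit_argmax ::
  "(real^'m) set \<Rightarrow> (real^'n \<Rightarrow> real^'m) \<Rightarrow> (real^'n) set \<Rightarrow> (real^'n) set \<Rightarrow>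
    (real^'n \<Rightarrow> ereal) \<Rightarrow> real \<Rightarrow> real^'n \<Rightarrow> real^'n" where
  "merit_argmax C F \<Omega> X w l x = arg_max_on (merit_obj C F X w l x) \<Omega>"

definition merit_argmax_well_defined ::
  "(real^'m) set \<Rightarrow> (real^'n \<Rightarrow> real^'m) \<Rightarrow> (real^'n) set \<Rightarrow> (real^'n) set \<Rightarrow>
    (real^'n \<Rightarrow> ereal) \<Rightarrow> real \<Rightarrow> bool" where
  "merit_argmax_well_defined C F \<Omega> X w l \<longleftrightarrow>
     (\<forall>x \<in> interior \<Omega>.
        (\<exists>!y. is_arg_max (merit_obj C F X w l x) (\<lambda>y. y \<in> \<Omega>) y) \<and>
        merit_argmax C F \<Omega> X w l x \<in> interior \<Omega>)"

end

theory Submission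
  imports Defs
begin

text \<open>
  On the domain of \<open>w\<close> the objective is \<open>h (J x (x - y)) - l D(y, x)\<close>, where
  \<open>h z = inf {c \<bullet> z | c \<in> G}\<close> is a concave 1-Lipschitz function. It is concave in \<open>y\<close>,
  and it is jointly continuous on the interior because a differentiable convex function has a
  continuous gradient. If the unique maximiser \<open>y\<^sub>0\<close> for the parameter \<open>x\<^sub>0\<close> is interior, then on a
  small sphere around \<open>y\<^sub>0\<close> the objective lies below its value at \<open>y\<^sub>0\<close> by a fixed amount; for \<open>x\<close> near
  \<open>x\<^sub>0\<close> it still lies below, and concavity along rays from \<open>y\<^sub>0\<close> keeps the new maximiser
  inside the sphere. The value function is then the composition of the objective with the continuous
  maximiser.
\<close>

subsection \<open>Gradients of convex functions\<close>

text \<open>Along the line through \<open>x\<close> and \<open>y\<close> the claim is the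
  one-variable tangent inequality at parameter 0, evaluated at parameter 1.\<close>

lemma convex_on_above_gradient:
  fixes f :: "'a::euclidean_space \<Rightarrow> real"
  assumes f: "convex_on U f" and U: "open U" and x: "x \<in> U" and y: "y \<in> U"
    and g: "GDERIV f x :> g"
  shows "f x + g \<bullet> (y - x) \<le> f y"
proof -
  define p where "p t = x + t *\<^sub>R (y - x)" for t :: real
  define A where "A = p -` U"
  have p_comb: "p ((1 - t) * a + t * b) = (1 - t) *\<^sub>R p a + t *\<^sub>R p b" for t a b
    unfolding p_def by (simp add: algebra_simps)
  have "continuous_on UNIV p"
    unfolding p_def by (intro continuous_intros)
  then have "open A"
    unfolding A_def using U by (simp add: continuous_on_open_vimage)
  have cU: "convex U"
    using f convex_on_imp_convex by blast
  have "convex A"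
    unfolding convex_alt A_def using cU p_comb by (auto simp: convex_alt)
  have "convex_on A (\<lambda>t. f (p t))"
  proof (rule convex_onI)
    fix t a b :: real assume "0 < t" "t < 1" "a \<in> A" "b \<in> A"
    then show "f (p ((1 - t) *\<^sub>R a + t *\<^sub>R b)) \<le> (1 - t) * f (p a) + t * f (p b)"
      using convex_onD[OF f, of t "p a" "p b"] by (simp add: p_comb A_def)
  qed (fact \<open>convex A\<close>)
  moreover have "((\<lambda>t. f (p t)) has_field_derivative (y - x) \<bullet> g) (at 0)"
  proof -
    have "(p has_derivative (\<lambda>t. t *\<^sub>R (y - x))) (at 0)"
      unfolding p_def by (auto intro!: derivative_eq_intros)
    moreover have "(f has_derivative (\<lambda>h. h \<bullet> g)) (at (p 0))"
      using g by (simp add: gderiv_def p_def)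
    ultimately have "((\<lambda>t. f (p t)) has_derivative (\<lambda>t. (t *\<^sub>R (y - x)) \<bullet> g)) (at 0)"
      by (rule has_derivative_compose)
    then show ?thesis
      by (simp add: has_field_derivative_def mult_commute_abs)
  qed
  moreover have "0 \<in> A" "1 \<in> A"
    using x y by (auto simp: A_def p_def)
  ultimately have "((y - x) \<bullet> g) * (1 - 0) \<le> f (p 1) - f (p 0)"
    using \<open>open A\<close> \<open>convex A\<close>
    by (intro convex_on_imp_above_tangent[where A = A])
      (auto simp: interior_open convex_connected intro: has_field_derivative_at_within)
  then show ?thesis
    by (simp add: p_def inner_commute)
qed

text \<open>If \<open>g x\<close> were far from \<open>g x0\<close>, the tangent at
  \<open>x\<close>, followed a short way along \<open>g x - g x0\<close>, would rise above the
  first-order upper bound that differentiability at \<open>x0\<close> imposes on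
  \<open>f\<close>.\<close>

lemma convex_on_continuous_gradient:
  fixes f :: "'a::euclidean_space \<Rightarrow> real"
  assumes f: "convex_on U f" and U: "open U" and g: "\<And>x. x \<in> U \<Longrightarrow> GDERIV f x :> g x"
  shows "continuous_on U g"
  unfolding continuous_on_iff
proof (intro ballI allI impI)
  fix x0 and e :: real assume x0: "x0 \<in> U" and e: "0 < e"
  \<comment> \<open>The final bound on the gradient difference is \<open>2 * r\<close>, that is
    \<open>e / 2\<close>.\<close>
  define r where "r = e / 4"
  have r: "0 < r" using e by (simp add: r_def)
  obtain d1 where d1: "0 < d1" "ball x0 d1 \<subseteq> U"
    using U x0 openE by blast
  have "(f has_derivative (\<lambda>h. h \<bullet> g x0)) (at x0)"
    using g[OF x0] by (simp add: gderiv_def)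
  then obtain d2 where d2: "0 < d2"
    and f_le: "\<And>y. norm (y - x0) < d2 \<Longrightarrow> norm (f y - f x0 - (y - x0) \<bullet> g x0) \<le> r * norm (y - x0)"
    using r unfolding has_derivative_at_alt by blast
  \<comment> \<open>The point \<open>x + z\<close> below lies within \<open>2 * s\<close> of
    \<open>x0\<close>, hence in \<open>U\<close> and in the range of the first-order
    estimate.\<close>
  define s where "s = min d1 d2 / 3"
  have s: "0 < s" "2 * s < d1" "2 * s < d2"
    using d1 d2 by (auto simp: s_def)
  show "\<exists>d>0. \<forall>x\<in>U. dist x x0 < d \<longrightarrow> dist (g x) (g x0) < e"
  proof (intro exI[of _ s] conjI ballI impI s(1))
    fix x assume x: "x \<in> U" and xs: "dist x x0 < s"
    \<comment> \<open>A step of length \<open>s\<close> along the gradient difference, so that their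
      inner product is \<open>s * norm (g x - g x0)\<close>; since \<open>sgn 0 = 0\<close>, this
      also holds for equal gradients.\<close>
    define z where "z = s *\<^sub>R sgn (g x - g x0)"
    have z: "norm z \<le> s"
      using s by (simp add: z_def norm_sgn)
    have nz: "norm (x + z - x0) \<le> 2 * s"
      using norm_triangle_ineq[of "x - x0" z] z xs by (simp add: dist_norm algebra_simps)
    have xz: "x + z \<in> U"
      using d1(2) nz s by (auto simp: dist_norm norm_minus_commute subset_iff)
    have "f (x + z) \<le> f x0 + (x + z - x0) \<bullet> g x0 + r * norm (x + z - x0)"
      using f_le[of "x + z"] nz s by (simp add: abs_le_iff)
    also have "\<dots> \<le> f x0 + (x + z - x0) \<bullet> g x0 + r * (2 * s)"
      using nz r by simp
    finally have "f (x + z) \<le> f x0 + (x + z - x0) \<bullet> g x0 + r * (2 * s)" .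
    moreover have "f x0 + g x0 \<bullet> (x - x0) \<le> f x"
      by (rule convex_on_above_gradient[OF f U x0 x g[OF x0]])
    moreover have "f x + g x \<bullet> (x + z - x) \<le> f (x + z)"
      by (rule convex_on_above_gradient[OF f U x xz g[OF x]])
    \<comment> \<open>Adding the three estimates cancels every value of \<open>f\<close>.\<close>
    ultimately have "(g x - g x0) \<bullet> z \<le> r * (2 * s)"
      by (simp add: inner_commute algebra_simps)
    moreover have "(g x - g x0) \<bullet> z = s * norm (g x - g x0)"
      by (cases "g x = g x0")
        (simp_all add: z_def sgn_div_norm power2_norm_eq_inner[symmetric] power2_eq_square)
    ultimately have "s * norm (g x - g x0) \<le> s * (2 * r)"
      by (simp add: mult_ac)
    then have "norm (g x - g x0) \<le> 2 * r"
      using s(1) by simp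
    then show "dist (g x) (g x0) < e"
      using e by (simp add: dist_norm r_def)
  qed
qed

lemma GDERIV_unique:
  assumes "GDERIV f x :> a" "GDERIV f x :> b"
  shows "a = b"
proof -
  have "(\<lambda>h. h \<bullet> a) = (\<lambda>h. h \<bullet> b)"
    using assms unfolding gderiv_def by (rule has_derivative_unique)
  then have "h \<bullet> a = h \<bullet> b" for h
    by metis
  then show ?thesis
    by (metis vector_eq_ldot)
qed

text \<open>The derivative is a linear functional, represented by its adjoint applied to 1.\<close>

lemma differentiable_imp_GDERIV:
  fixes f :: "'a::euclidean_space \<Rightarrow> real"
  assumes "f differentiable at x"
  obtains g where "GDERIV f x :> g"
proof -
  obtain f' where f': "(f has_derivative f') (at x)"
    using assms differentiable_def by blast
  then have "linear f'"
    by (rule has_derivative_linear)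
  then have "f' = (\<lambda>h. h \<bullet> adjoint f' 1)"
    using adjoint_works[of f' _ 1] by (simp add: fun_eq_iff)
  with f' have "GDERIV f x :> adjoint f' 1"
    unfolding gderiv_def by simp
  then show ?thesis ..
qed

text \<open>Gradients are unique, so the definite description in \<open>egrad\<close> picks the
  actual gradient.\<close>

lemma GDERIV_egrad:
  assumes "(\<lambda>z. real_of_ereal (w z)) differentiable (at x)"
  shows "GDERIV (\<lambda>z. real_of_ereal (w z)) x :> egrad w x"
proof -
  obtain g where g: "GDERIV (\<lambda>z. real_of_ereal (w z)) x :> g"
    using assms differentiable_imp_GDERIV by blast
  show ?thesis
    unfolding egrad_def by (rule theI[where a = g]) (use g GDERIV_unique in blast)+
qed

subsection \<open>Continuity of maximisers\<close>

text \<open>Concavity stands in for compactness of \<open>D\<close>: a maximiser far from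
  \<open>V x0\<close> would force large values on a small sphere around \<open>V x0\<close>. Joint
  continuity is therefore used only inside the open set \<open>T\<close>.\<close>

lemma continuous_on_concave_maximiser:
  fixes \<phi> :: "'a::topological_space \<Rightarrow> 'b::euclidean_space \<Rightarrow> real"
  assumes T: "open T" "T \<subseteq> D"
    and concave: "\<And>x. x \<in> S \<Longrightarrow> concave_on D (\<phi> x)"
    and cont: "continuous_on (S \<times> T) (\<lambda>(x, y). \<phi> x y)"
    and V: "\<And>x. x \<in> S \<Longrightarrow> V x \<in> T"
    and max: "\<And>x y. x \<in> S \<Longrightarrow> y \<in> D \<Longrightarrow> y \<noteq> V x \<Longrightarrow> \<phi> x y < \<phi> x (V x)"
  shows "continuous_on S V"
  unfolding continuous_on_def
proof (intro ballI tendstoI)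
  fix x0 and e :: real assume x0: "x0 \<in> S" and e: "0 < e"
  define y0 where "y0 = V x0"
  have y0: "y0 \<in> T"
    using V x0 by (simp add: y0_def)
  obtain r0 where r0: "0 < r0" "cball y0 r0 \<subseteq> T"
    using T(1) y0 open_contains_cball by blast
  define r where "r = min r0 (e / 2)"
  have r: "0 < r" "r < e" "cball y0 r \<subseteq> T"
    using r0 e by (auto simp: r_def)
  define K where "K = sphere y0 r"
  have K: "compact K" "K \<subseteq> T"
    using r by (auto simp: K_def)
  \<comment> \<open>Subtracting the value at \<open>y0\<close> for the same parameter turns the
    comparison with \<open>y0\<close> into a sign condition.\<close>
  define \<psi> where "\<psi> = (\<lambda>(x, y). \<phi> x y - \<phi> x y0)"
  have cont\<psi>: "continuous_on (S \<times> K) \<psi>"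
  proof -
    have "continuous_on (S \<times> K) (\<lambda>(x, y). \<phi> x y)"
      using cont by (rule continuous_on_subset) (use K(2) in auto)
    moreover have "continuous_on (S \<times> K) (\<lambda>p. (fst p, y0))"
      by (intro continuous_intros)
    then have "continuous_on (S \<times> K) (\<lambda>(x, y). \<phi> x y0)"
      using continuous_on_compose2[OF cont] y0 by (fastforce simp: case_prod_unfold)
    ultimately show ?thesis
      unfolding \<psi>_def case_prod_unfold by (rule continuous_on_diff)
  qed
  have "\<exists>d>0. \<forall>y\<in>K. \<psi> (x0, y) \<le> - d"
  proof (cases "K = {}")
    case False
    have "continuous_on K (\<lambda>y. \<psi> (x0, y))"
      using x0 by (intro continuous_on_compose2[OF cont\<psi>] continuous_intros) auto
    then obtain y1 where y1: "y1 \<in> K" "\<forall>y\<in>K. \<psi> (x0, y) \<le> \<psi> (x0, y1)"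
      using continuous_attains_sup[OF K(1) False] by blast
    have "y1 \<noteq> V x0"
      using y1(1) r by (auto simp: K_def y0_def)
    then have "\<psi> (x0, y1) < 0"
      using max[OF x0, of y1] K(2) T(2) y1(1) by (auto simp: \<psi>_def y0_def)
    then show ?thesis
      using y1 by (intro exI[of _ "- \<psi> (x0, y1)"]) auto
  qed (auto intro: exI[of _ 1])
  then obtain d where d: "0 < d" "\<forall>y\<in>K. \<psi> (x0, y) \<le> - d"
    by blast
  obtain X0 where X0: "x0 \<in> X0" "open X0"
    and near: "\<forall>x\<in>X0 \<inter> S. \<forall>y\<in>K. dist (\<psi> (x, y)) (\<psi> (x0, y)) \<le> d / 2"
    \<comment> \<open>Compactness of \<open>K\<close> makes the neighbourhood \<open>X0\<close>
      uniform in \<open>y\<close>; the error \<open>d / 2\<close> leaves \<psi> at most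
      \<open>- d / 2\<close> on \<open>K\<close>.\<close>
    using continuous_on_prod_compactE[OF cont\<psi> K(1) x0, of "d / 2"] d(1) by auto
  have "dist (V x) (V x0) < e" if x: "x \<in> X0" "x \<in> S" for x
  proof (rule ccontr)
    assume "\<not> dist (V x) (V x0) < e"
    then have far: "r < dist y0 (V x)"
      using r by (simp add: y0_def dist_commute)
    \<comment> \<open>The parameter at which the segment from \<open>y0\<close> to
      \<open>V x\<close> crosses the sphere \<open>K\<close>.\<close>
    define t where "t = r / dist y0 (V x)"
    have t: "0 \<le> t" "t \<le> 1"
      using far r by (auto simp: t_def divide_simps)
    define z where "z = (1 - t) *\<^sub>R y0 + t *\<^sub>R V x"
    have "y0 - z = t *\<^sub>R (y0 - V x)"
      by (simp add: z_def algebra_simps)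
    then have "dist y0 z = t * dist y0 (V x)"
      using t by (simp add: dist_norm)
    also have "\<dots> = r"
      using far r by (auto simp: t_def)
    finally have zK: "z \<in> K"
      by (simp add: K_def)
    have "\<psi> (x, z) - \<psi> (x0, z) \<le> d / 2"
      using near x zK abs_ge_self order_trans unfolding dist_real_def by blast
    moreover have "\<psi> (x0, z) \<le> - d"
      using d(2) zK by blast
    ultimately have "\<phi> x z < \<phi> x y0"
      using d(1) by (simp add: \<psi>_def)
    moreover have "(1 - t) * \<phi> x y0 + t * \<phi> x (V x) \<le> \<phi> x z"
      unfolding z_def using concave_onD[OF concave[OF x(2)] t] y0 V[OF x(2)] T(2) by blast
    moreover have "\<phi> x y0 \<le> \<phi> x (V x)"
      using max[OF x(2), of y0] y0 T(2) by (cases "y0 = V x") (auto simp: subset_iff less_imp_le)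
    \<comment> \<open>With the concavity estimate this gives
      \<open>\<phi> x y0 \<le> \<phi> x z\<close>, against the strict inequality on the
      sphere.\<close>
    then have "t * \<phi> x y0 \<le> t * \<phi> x (V x)"
      using t by (simp add: mult_left_mono)
    ultimately show False
      by (simp add: algebra_simps)
  qed
  then show "\<forall>\<^sub>F x in at x0 within S. dist (V x) (V x0) < e"
    using X0 unfolding eventually_at_topological by blast
qed

subsection \<open>Lower support functions\<close>

text \<open>For nonempty bounded \<open>G\<close> this is \<open>- h (- z)\<close>, where
  \<open>h\<close> is the support function of \<open>G\<close>. The infimum is taken in the reals,
  hence the bound \<open>B\<close> in the lemmas that follow.\<close>

definition lower_support :: "'a::real_inner set \<Rightarrow> 'a \<Rightarrow> real" where
  "lower_support G z = (INF c\<in>G. c \<bullet> z)"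

lemma bdd_below_inner:
  fixes G :: "'a::real_inner set"
  assumes "\<And>c. c \<in> G \<Longrightarrow> norm c \<le> B"
  shows "bdd_below ((\<lambda>c. c \<bullet> z) ` G)"
proof (rule bdd_belowI2)
  fix c assume "c \<in> G"
  then have "norm c * norm z \<le> B * norm z"
    using assms by (intro mult_right_mono) auto
  then show "- (B * norm z) \<le> c \<bullet> z"
    using Cauchy_Schwarz_ineq2[of c z] by linarith
qed

lemma lower_support_superadditive:
  fixes G :: "'a::real_inner set"
  assumes "G \<noteq> {}" and B: "\<And>c. c \<in> G \<Longrightarrow> norm c \<le> B"
  shows "lower_support G x + lower_support G y \<le> lower_support G (x + y)"
proof -
  have "lower_support G x + lower_support G y \<le> c \<bullet> (x + y)" if "c \<in> G" for c
    unfolding lower_support_def inner_add_right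
    using that bdd_below_inner[OF B] by (intro add_mono cINF_lower) auto
  then show ?thesis
    unfolding lower_support_def[of G "x + y"] using assms(1) by (intro cINF_greatest) auto
qed

lemma lower_support_scaleR_ge:
  fixes G :: "'a::real_inner set"
  assumes "G \<noteq> {}" and B: "\<And>c. c \<in> G \<Longrightarrow> norm c \<le> B" and "0 \<le> t"
  shows "t * lower_support G x \<le> lower_support G (t *\<^sub>R x)"
proof -
  have "t * lower_support G x \<le> c \<bullet> (t *\<^sub>R x)" if "c \<in> G" for c
    unfolding lower_support_def inner_scaleR_right
    using that bdd_below_inner[OF B] \<open>0 \<le> t\<close> by (intro mult_left_mono cINF_lower) auto
  then show ?thesis
    unfolding lower_support_def[of G "t *\<^sub>R x"] using assms(1) by (intro cINF_greatest) auto
qed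

lemma lower_support_concave:
  fixes G :: "'a::real_inner set"
  assumes "G \<noteq> {}" "\<And>c. c \<in> G \<Longrightarrow> norm c \<le> B" "0 \<le> t" "t \<le> 1"
  shows "(1 - t) * lower_support G x + t * lower_support G y
    \<le> lower_support G ((1 - t) *\<^sub>R x + t *\<^sub>R y)"
  using lower_support_superadditive[of G B "(1 - t) *\<^sub>R x" "t *\<^sub>R y"]
    lower_support_scaleR_ge[of G B "1 - t" x] lower_support_scaleR_ge[of G B t y] assms
  by fastforce

text \<open>A pointwise infimum of \<open>B\<close>-Lipschitz functions is
  \<open>B\<close>-Lipschitz.\<close>

lemma continuous_on_lower_support:
  fixes G :: "'a::real_inner set"
  assumes "G \<noteq> {}" and B: "\<And>c. c \<in> G \<Longrightarrow> norm c \<le> B"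
  shows "continuous_on S (lower_support G)"
proof -
  have *: "lower_support G x - lower_support G y \<le> B * norm (x - y)" for x y
  proof -
    have "lower_support G x - B * norm (x - y) \<le> c \<bullet> y" if c: "c \<in> G" for c
    proof -
      have "lower_support G x \<le> c \<bullet> x"
        unfolding lower_support_def using c bdd_below_inner[OF B] by (intro cINF_lower)
      also have "c \<bullet> x \<le> c \<bullet> y + norm c * norm (x - y)"
        using norm_cauchy_schwarz[of c "x - y"] by (simp add: inner_diff_right)
      also have "\<dots> \<le> c \<bullet> y + B * norm (x - y)"
        using B[OF c] by (intro add_left_mono mult_right_mono) auto
      finally show ?thesis by simp
    qed
    then have "lower_support G x - B * norm (x - y) \<le> lower_support G y"
      unfolding lower_support_def[of G y] using assms(1) by (intro cINF_greatest) auto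
    then show ?thesis by simp
  qed
  have "0 \<le> B"
    using assms by (metis all_not_in_conv norm_ge_zero order_trans)
  moreover have "dist (lower_support G x) (lower_support G y) \<le> B * dist x y" for x y
    using *[of x y] *[of y x] by (simp add: dist_norm norm_minus_commute abs_le_iff)
  ultimately have "B-lipschitz_on S (lower_support G)"
    by (intro lipschitz_onI)
  then show ?thesis
    by (rule lipschitz_on_continuous_on)
qed

text \<open>The closed unit ball is convex and contains the generating unit vectors, hence their
  hull.\<close>

lemma norm_dual_generator_le:
  assumes "c \<in> dual_generator C"
  shows "norm c \<le> 1"
proof -
  have "dual_generator C \<subseteq> cball 0 1"
    unfolding dual_generator_def by (rule hull_minimal) auto
  then show ?thesis
    using assms by auto
qed

subsection \<open>The merit objective\<close>

lemma legendre_finite: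
  assumes "legendre X w" "y \<in> edom X w"
  shows "w y = ereal (real_of_ereal (w y))"
  using assms by (cases "w y") (auto simp: legendre_def proper_fun_def edom_def)

text \<open>Convexity of the epigraph, applied to the points \<open>(x, ?f x)\<close> and
  \<open>(y, ?f y)\<close>, yields convexity of the domain and the inequality at once. Properness
  lets real values replace extended ones.\<close>

lemma legendre_convex:
  assumes w: "legendre X w"
  shows "convex_on (edom X w) (\<lambda>y. real_of_ereal (w y))"
proof -
  let ?f = "\<lambda>y. real_of_ereal (w y)"
  have epi: "convex (eepigraph X w)"
    using w by (simp add: legendre_def)
  have *: "(1 - t) *\<^sub>R x + t *\<^sub>R y \<in> edom X w \<and>
      ?f ((1 - t) *\<^sub>R x + t *\<^sub>R y) \<le> (1 - t) * ?f x + t * ?f y"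
    if t: "0 \<le> t" "t \<le> 1" and xy: "x \<in> edom X w" "y \<in> edom X w" for x y t
  proof -
    have "(x, ?f x) \<in> eepigraph X w" "(y, ?f y) \<in> eepigraph X w"
      using xy legendre_finite[OF w] by (auto simp: eepigraph_def edom_def)
    then have "(1 - t) *\<^sub>R (x, ?f x) + t *\<^sub>R (y, ?f y) \<in> eepigraph X w"
      using epi t unfolding convex_alt by blast
    then have le: "(1 - t) *\<^sub>R x + t *\<^sub>R y \<in> X"
      "w ((1 - t) *\<^sub>R x + t *\<^sub>R y) \<le> ereal ((1 - t) * ?f x + t * ?f y)"
      by (auto simp: eepigraph_def)
    then have dom: "(1 - t) *\<^sub>R x + t *\<^sub>R y \<in> edom X w"
      by (auto simp: edom_def)
    then show ?thesis
      using le(2) legendre_finite[OF w dom] by (metis ereal_less_eq(3))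
  qed
  then have "convex (edom X w)"
    unfolding convex_alt by blast
  then show ?thesis
    using * by (intro convex_onI) auto
qed

text \<open>The Bregman term does not depend on \<open>c\<close> and is finite here, so it leaves
  the infimum. As \<open>dual_generator C\<close> is nonempty and bounded, the extended infimum
  agrees with the real one.\<close>

lemma merit_obj_eq:
  fixes F :: "real^'n \<Rightarrow> real^'m"
  assumes w: "legendre X w" and x: "x \<in> edom X w" and y: "y \<in> edom X w"
    and G: "dual_generator C \<noteq> {}"
  shows "merit_obj C F X w l x y =
    ereal (lower_support (dual_generator C) (jacobian F (at x) *v (x - y))
      - l * (real_of_ereal (w y) - real_of_ereal (w x) - egrad w x \<bullet> (y - x)))"
    (is "_ = ereal (?h - l * ?b)")
proof -
  let ?z = "jacobian F (at x) *v (x - y)"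
  have b: "bregman X w y x = ereal ?b"
    using y legendre_finite[OF w x] legendre_finite[OF w y]
    by (metis bregman_def ereal_minus(1))
  have bdd: "bdd_below ((\<lambda>c. c \<bullet> ?z) ` dual_generator C)"
    using norm_dual_generator_le by (rule bdd_below_inner)
  then have bdd': "bdd_below ((\<lambda>c. c \<bullet> ?z - l * ?b) ` dual_generator C)"
    by (meson bdd_below.E bdd_belowI2 diff_right_mono imageI)
  have "merit_obj C F X w l x y = (INF c\<in>dual_generator C. ereal (c \<bullet> ?z - l * ?b))"
    by (simp add: merit_obj_def b)
  also have "\<dots> = ereal (INF c\<in>dual_generator C. c \<bullet> ?z - l * ?b)"
    using ereal_Inf'[OF bdd'] G by (simp add: image_comp)
  also have "(INF c\<in>dual_generator C. c \<bullet> ?z - l * ?b) = ?h - l * ?b"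
  proof (rule antisym)
    show "?h - l * ?b \<le> (INF c\<in>dual_generator C. c \<bullet> ?z - l * ?b)"
      unfolding lower_support_def using G bdd
      by (intro cINF_greatest diff_right_mono cINF_lower) auto
    have "(INF c\<in>dual_generator C. c \<bullet> ?z - l * ?b) + l * ?b \<le> c \<bullet> ?z"
      if "c \<in> dual_generator C" for c
      using cINF_lower[OF bdd' that] by linarith
    then have "(INF c\<in>dual_generator C. c \<bullet> ?z - l * ?b) + l * ?b \<le> ?h"
      unfolding lower_support_def using G by (intro cINF_greatest)
    then show "(INF c\<in>dual_generator C. c \<bullet> ?z - l * ?b) \<le> ?h - l * ?b"
      by simp
  qed
  finally show ?thesis .
qed

text \<open>
  For an empty \<open>dual_generator C\<close> the objective is constantly \<open>\<infinity>\<close>, so the maximiser over a set with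
  interior points is not unique.
\<close>

lemma well_defined_dual_generator:
  assumes "merit_argmax_well_defined C F \<Omega> X w l" "interior \<Omega> \<noteq> {}"
  shows "dual_generator C \<noteq> {}"
proof
  assume G: "dual_generator C = {}"
  obtain x where x: "x \<in> interior \<Omega>"
    using assms(2) by blast
  have "is_arg_max (merit_obj C F X w l x) (\<lambda>y. y \<in> \<Omega>) y" if "y \<in> \<Omega>" for y
    using that G by (simp add: is_arg_max_def merit_obj_def)
  moreover have "\<exists>!y. is_arg_max (merit_obj C F X w l x) (\<lambda>y. y \<in> \<Omega>) y"
    using assms(1) x by (auto simp: merit_argmax_well_defined_def)
  ultimately have "\<Omega> \<subseteq> {x}"
    using x interior_subset by blast
  then have "interior \<Omega> \<subseteq> {}"
    using interior_mono[of \<Omega> "{x}"] by simp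
  then show False
    using assms(2) by simp
qed

theorem proposition4:
  fixes C :: "(real^'m) set"
    and F :: "real^'n \<Rightarrow> real^'m"
    and \<Omega> X :: "(real^'n) set"
    and w :: "real^'n \<Rightarrow> ereal"
    and l :: real
  assumes "closed C" "convex C" "cone C" "pointed C" "interior C \<noteq> {}"
    and "closed \<Omega>" "convex \<Omega>" "interior \<Omega> \<noteq> {}"
    and "\<And>i x. (\<lambda>z. F z $ i) differentiable (at x)"
    and "continuous_on (interior \<Omega>) (\<lambda>x. jacobian F (at x))"
    and "legendre X w" "closure (edom X w) = \<Omega>"
    and "l > 0"
    and "merit_argmax_well_defined C F \<Omega> X w l"
  shows "continuous_on (interior \<Omega>) (merit C F \<Omega> X w l) \<and>
         continuous_on (interior \<Omega>) (merit_argmax C F \<Omega> X w l)"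
proof -
  define U where "U = interior \<Omega>"
  define D where "D = edom X w"
  define G where "G = dual_generator C"
  define f where "f = (\<lambda>y. real_of_ereal (w y))"
  define J where "J = (\<lambda>x. jacobian F (at x))"
  define V where "V = merit_argmax C F \<Omega> X w l"
  define \<phi> where "\<phi> x y = lower_support G (J x *v (x - y)) - l * (f y - f x - egrad w x \<bullet> (y - x))"
    for x y
  have G: "G \<noteq> {}"
    unfolding G_def using assms(14,8) by (rule well_defined_dual_generator)
  have G1: "\<And>c. c \<in> G \<Longrightarrow> norm c \<le> 1"
    unfolding G_def by (rule norm_dual_generator_le)
  have f: "convex_on D f"
    unfolding f_def D_def using assms(11) by (rule legendre_convex)
  have D: "convex D"
    using f by (rule convex_on_imp_convex)
  \<comment> \<open>A convex set and its closure have the same interior, so smoothness on the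
    interior of the domain applies on all of \<open>U\<close>.\<close>
  have U: "U = interior D"
    using convex_interior_closure[OF D] assms(12) by (simp add: U_def D_def)
  have UD: "U \<subseteq> D"
    unfolding U by (rule interior_subset)
  have D\<Omega>: "D \<subseteq> \<Omega>"
    using assms(12) closure_subset by (auto simp: D_def)
  have openU: "open U"
    by (simp add: U)
  have fU: "convex_on U f"
    using f UD by (rule convex_on_subset) (simp add: U D convex_interior)
  have contf: "continuous_on U f"
    using openU fU by (rule convex_on_continuous)
  have contg: "continuous_on U (egrad w)"
  proof (rule convex_on_continuous_gradient[OF fU openU])
    fix x assume "x \<in> U"
    then show "GDERIV f x :> egrad w x"
      using assms(11) GDERIV_egrad unfolding f_def U D_def legendre_def essentially_smooth_def
      by blast
  qed
  \<comment> \<open>The assumed continuity of the Jacobian enters here; it makes the linear term of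
    the objective depend continuously on \<open>x\<close>.\<close>
  have contJ: "continuous_on U J"
    using assms(10) by (simp add: U_def J_def)

  have obj: "merit_obj C F X w l x y = ereal (\<phi> x y)" if "x \<in> U" "y \<in> D" for x y
    unfolding \<phi>_def G_def f_def J_def
    using that UD G by (intro merit_obj_eq[OF assms(11)]) (auto simp: D_def G_def)
  have concave: "concave_on D (\<phi> x)" for x
    unfolding concave_on_iff
  proof (intro conjI D ballI allI impI)
    fix y z u v assume yz: "y \<in> D" "z \<in> D" and uv: "0 \<le> u" "0 \<le> v" "u + v = (1::real)"
    have u: "u = 1 - v" using uv by simp
    \<comment> \<open>As \<open>u + v = 1\<close>, the vector \<open>x\<close> splits with the same
      weights.\<close>
    have "J x *v (x - (u *\<^sub>R y + v *\<^sub>R z)) = u *\<^sub>R (J x *v (x - y)) + v *\<^sub>R (J x *v (x - z))"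
      by (simp add: u algebra_simps matrix_vector_mult_diff_distrib matrix_vector_right_distrib
          matrix_vector_mult_scaleR)
    then have "u * lower_support G (J x *v (x - y)) + v * lower_support G (J x *v (x - z))
        \<le> lower_support G (J x *v (x - (u *\<^sub>R y + v *\<^sub>R z)))"
      using lower_support_concave[OF G G1, of v] uv unfolding u by simp
    moreover have "l * f (u *\<^sub>R y + v *\<^sub>R z) \<le> l * (u * f y + v * f z)"
      using convex_onD[OF f, of v y z] yz uv assms(13) unfolding u by (intro mult_left_mono) auto
    ultimately show "u * \<phi> x y + v * \<phi> x z \<le> \<phi> x (u *\<^sub>R y + v *\<^sub>R z)"
      unfolding \<phi>_def u by (simp add: algebra_simps)
  qed
  have cont\<phi>: "continuous_on (U \<times> U) (\<lambda>(x, y). \<phi> x y)"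
  proof -
    have f1: "continuous_on (U \<times> U) (\<lambda>p. f (fst p))" "continuous_on (U \<times> U) (\<lambda>p. f (snd p))"
      by (rule continuous_on_compose2[OF contf]; auto intro: continuous_intros)+
    have g1: "continuous_on (U \<times> U) (\<lambda>p. egrad w (fst p))"
      by (rule continuous_on_compose2[OF contg]; auto intro: continuous_intros)
    have J1: "continuous_on (U \<times> U) (\<lambda>p. J (fst p))"
      by (rule continuous_on_compose2[OF contJ]; auto intro: continuous_intros)
    have "continuous_on (U \<times> U) (\<lambda>p. J (fst p) *v (fst p - snd p))"
      unfolding matrix_vector_mult_def using J1
      by (intro continuous_intros continuous_on_vec_lambda)
    then have "continuous_on (U \<times> U) (\<lambda>p. lower_support G (J (fst p) *v (fst p - snd p)))"
      using continuous_on_compose2[OF continuous_on_lower_support[OF G G1, of UNIV]] by auto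
    then show ?thesis
      unfolding \<phi>_def case_prod_unfold by (intro continuous_intros f1 g1)
  qed

  have VU: "V x \<in> U" if "x \<in> U" for x
    using that assms(14) by (simp add: V_def U_def merit_argmax_well_defined_def)
  have ex1: "\<exists>!y. is_arg_max (merit_obj C F X w l x) (\<lambda>y. y \<in> \<Omega>) y" if "x \<in> U" for x
    using that assms(14) by (simp add: U_def merit_argmax_well_defined_def)
  \<comment> \<open>\<open>arg_max_on\<close> is a choice operator; the assumed existence makes its
    value a true maximiser.\<close>
  have argmax: "is_arg_max (merit_obj C F X w l x) (\<lambda>y. y \<in> \<Omega>) (V x)" if "x \<in> U" for x
    unfolding V_def merit_argmax_def arg_max_on_def arg_max_def
    using ex1[OF that] by (rule ex1_implies_ex[THEN someI_ex])
  \<comment> \<open>Strictness comes from uniqueness: a point of \<open>D\<close> doing at least as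
    well as \<open>V x\<close> would be a second maximiser over \<Omega>.\<close>
  have max: "\<phi> x y < \<phi> x (V x)" if x: "x \<in> U" and y: "y \<in> D" and ne: "y \<noteq> V x" for x y
  proof (rule ccontr)
    assume "\<not> \<phi> x y < \<phi> x (V x)"
    then have "merit_obj C F X w l x (V x) \<le> merit_obj C F X w l x y"
      using obj[OF x y] obj[OF x, of "V x"] VU[OF x] UD by auto
    then have "is_arg_max (merit_obj C F X w l x) (\<lambda>y. y \<in> \<Omega>) y"
      using argmax[OF x] y D\<Omega> unfolding is_arg_max_linorder by (meson order_trans subsetD)
    then show False
      using ex1[OF x] argmax[OF x] ne by blast
  qed
  have contV: "continuous_on U V"
    using openU UD concave cont\<phi> VU max by (rule continuous_on_concave_maximiser)
  have merit: "merit C F \<Omega> X w l x = ereal (\<phi> x (V x))" if x: "x \<in> U" for x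
  proof -
    \<comment> \<open>The supremum is attained at \<open>V x\<close>, which lies in the region where
      the objective is finite and equals \<phi>.\<close>
    have "merit C F \<Omega> X w l x = merit_obj C F X w l x (V x)"
      unfolding merit_def using argmax[OF x] unfolding is_arg_max_linorder
      by (intro SUP_eqI) auto
    then show ?thesis
      using obj[OF x, of "V x"] VU[OF x] UD by auto
  qed
  have "continuous_on U (\<lambda>x. (x, V x))"
    using contV by (intro continuous_intros)
  then have "continuous_on U (\<lambda>x. \<phi> x (V x))"
    using continuous_on_compose2[OF cont\<phi>] VU by fastforce
  then have "continuous_on U (\<lambda>x. ereal (\<phi> x (V x)))"
    by (rule continuous_on_ereal)
  then have "continuous_on U (merit C F \<Omega> X w l)"
    using merit by (simp cong: continuous_on_cong)
  then show ?thesis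
    using contV by (simp add: U_def V_def)
qed

end
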